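(* Let $Y=(Y_1,\dots,Y_K)$ be a random vector in $\mathbb{R}^K$ with $\mathbb{E}[Y_k]=0$ for each $k$ and $\mathbb{E}[\max_{1\le k\le K}|Y_k|]<\infty$, and let $\varphi_K(u)=\mathbb{E}[\max_k(u_k+Y_k)]-\max_k u_k$ for $u\in\mathbb{R}^K$. Then: (i) $\varphi_K(u)\ge 0$ for all $u\in\mathbb{R}^K$. (ii) If $K=1$, then $\varphi_1(u)=0$ for all $u\in\mathbb{R}$. (iii) For every $u\in\mathbb{R}^K$ and every constant $c\in\mathbb{R}$, $\varphi_K(u+c\mathbf{1})=\varphi_K(u)$, where $\mathbf{1}=(1,\dots,1)\in\mathbb{R}^K$. (iv) Suppose $|Y_k|\le b$ almost surely for all $k$, and let $u\in\mathbb{R}^K$ and $k^*\in\arg\max_k u_k$ be such that $\max_k u_k-\max_{j\ne k^*}u_j>2b$. Then $\varphi_K(u)=0$. (v) $\varphi_K(u)\le\varphi_K(\mathbf{0})$ for all $u\in\mathbb{R}^K$, where $\mathbf{0}=(0,\dots,0)\in\mathbb{R}^K$.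
   Context: $K\ge 1$ is an integer and all maxima over $k$ are over $k\in\{1,\dots,K\}$. The function $\varphi_K$ is called the selection premium function. The coordinates of $Y$ may be dependent. In the source, $Y$ has the distribution of a one-step increment vector of $K$ parallel random walks driven by common observations. Part (iv) has content for $K\ge 2$. *)

theory Defs
  imports "HOL-Probability.Probability"
begin

text \<open>The finite index type \<open>'k\<close> plays the role of \<open>{1,\<dots>,K}\<close>, so \<open>K = CARD('k) \<ge> 1\<close> is automatic.\<close>

definition selection_premium ::
    "'a measure \<Rightarrow> ('a \<Rightarrow> real ^ 'k::finite) \<Rightarrow> real ^ 'k \<Rightarrow> real" where
  "selection_premium M Y u =
     prob_space.expectation M (\<lambda>\<omega>. MAX k. u $ k + Y \<omega> $ k) - (MAX k. u $ k)"

end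

theory Submission imports Defs begin

text \<open>Jensen's inequality for the convex function \<open>max\<close> takes the elementary form
  \<open>u\<^sub>i + Y\<^sub>i \<le> max\<^sub>k (u\<^sub>k + Y\<^sub>k)\<close>, integrated at a maximizer \<open>i\<close> of \<open>u\<close>; this gives
  nonnegativity. The upper bound comes from subadditivity
  \<open>max\<^sub>k (u\<^sub>k + Y\<^sub>k) \<le> max\<^sub>k u\<^sub>k + max\<^sub>k Y\<^sub>k\<close>. When one index \<open>i\<close> attains both
  \<open>max\<^sub>k u\<^sub>k\<close> and, almost surely, \<open>max\<^sub>k (u\<^sub>k + Y\<^sub>k)\<close>, the premium is the mean of \<open>Y\<^sub>i\<close>,
  that is, zero; this covers both \<open>K = 1\<close> and the case of a large gap.\<close>

lemma integrable_Max:
  fixes f :: "'i \<Rightarrow> 'a \<Rightarrow> real"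
  assumes "finite I" "I \<noteq> {}" "\<And>i. i \<in> I \<Longrightarrow> integrable M (f i)"
  shows "integrable M (\<lambda>x. MAX i\<in>I. f i x)"
  using assms by (induction I rule: finite_ne_induct) (auto simp: Max_insert intro: integrable_max)

text \<open>Integrability is asked of single components only: over a finite index type this already
  makes every shifted maximum integrable.\<close>

locale centered_increment = prob_space M for M :: "'a measure" +
  fixes Y :: "'a \<Rightarrow> real ^ 'k::finite"
  assumes integrable_component: "integrable M (\<lambda>\<omega>. Y \<omega> $ k)"
    and expectation_component: "expectation (\<lambda>\<omega>. Y \<omega> $ k) = 0"
begin

lemma integrable_shifted_Max: "integrable M (\<lambda>\<omega>. MAX k. u $ k + Y \<omega> $ k)"
  by (intro integrable_Max) (auto intro: integrable_component)

lemma expectation_shifted_component: "expectation (\<lambda>\<omega>. u $ k + Y \<omega> $ k) = u $ k"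
  using integrable_component expectation_component by (simp add: prob_space)

lemma selection_premium_nonneg: "0 \<le> selection_premium M Y u"
proof -
  \<comment> \<open>Proving the bound for every index avoids choosing a maximizer: the expectation
    bounds all \<open>u $ i\<close>, hence their maximum.\<close>
  have "u $ i \<le> expectation (\<lambda>\<omega>. MAX k. u $ k + Y \<omega> $ k)" for i
  proof -
    have "expectation (\<lambda>\<omega>. u $ i + Y \<omega> $ i) \<le> expectation (\<lambda>\<omega>. MAX k. u $ k + Y \<omega> $ k)"
      by (intro integral_mono integrable_shifted_Max) (auto intro: integrable_component)
    then show ?thesis
      by (simp only: expectation_shifted_component)
  qed
  then have "(MAX k. u $ k) \<le> expectation (\<lambda>\<omega>. MAX k. u $ k + Y \<omega> $ k)"
    by (intro Max.boundedI) auto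
  then show ?thesis
    by (simp add: selection_premium_def)
qed

text \<open>A common shift passes through both maxima and, since \<open>M\<close> has total mass 1,
  through the expectation; the two copies of \<open>c\<close> cancel.\<close>

lemma selection_premium_translate:
  "selection_premium M Y (u + c *\<^sub>R 1) = selection_premium M Y u"
proof -
  have "(MAX k. (u + c *\<^sub>R 1) $ k + Y \<omega> $ k) = (MAX k. u $ k + Y \<omega> $ k) + c" for \<omega>
    by (subst Max_add_commute[symmetric]) (auto simp: algebra_simps)
  moreover have "(MAX k. (u + c *\<^sub>R 1) $ k) = (MAX k. u $ k) + c"
    by (subst Max_add_commute[symmetric]) auto
  ultimately show ?thesis
    using integrable_shifted_Max[of u] by (simp add: selection_premium_def prob_space)
qed

lemma selection_premium_eq_0_if_dominant:
  assumes "(MAX k. u $ k) = u $ i"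
    and "AE \<omega> in M. (MAX k. u $ k + Y \<omega> $ k) = u $ i + Y \<omega> $ i"
  shows "selection_premium M Y u = 0"
proof -
  have "expectation (\<lambda>\<omega>. MAX k. u $ k + Y \<omega> $ k) = expectation (\<lambda>\<omega>. u $ i + Y \<omega> $ i)"
    using assms(2) integrable_shifted_Max[of u] integrable_component[of i]
    by (intro integral_cong_AE) (auto intro: borel_measurable_integrable)
  then show ?thesis
    by (simp only: selection_premium_def assms(1) expectation_shifted_component diff_self)
qed

lemma selection_premium_card_1:
  assumes "CARD('k) = 1"
  shows "selection_premium M Y u = 0"
proof -
  obtain i :: 'k where "(UNIV :: 'k set) = {i}"
    using assms by (auto simp: card_1_singleton_iff)
  then have "(MAX k. f k) = f i" for f :: "'k \<Rightarrow> real"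
    by (metis Max_singleton image_empty image_insert)
  then show ?thesis
    by (intro selection_premium_eq_0_if_dominant[of u i]) auto
qed

text \<open>The noise changes the difference of two coordinates by at most \<open>2 * b\<close>, so
  almost surely no other index overtakes \<open>i\<close>. A weak gap is enough, as ties leave the
  value of the maximum unchanged.\<close>

lemma selection_premium_eq_0_if_gap:
  assumes bound: "AE \<omega> in M. \<forall>k. \<bar>Y \<omega> $ k\<bar> \<le> b"
    and gap: "\<And>j. j \<noteq> i \<Longrightarrow> u $ j + 2 * b \<le> u $ i"
    and max: "\<And>j. u $ j \<le> u $ i"
  shows "selection_premium M Y u = 0"
proof (rule selection_premium_eq_0_if_dominant)
  show "(MAX k. u $ k) = u $ i"
    using max by (intro Max_eqI) auto
  show "AE \<omega> in M. (MAX k. u $ k + Y \<omega> $ k) = u $ i + Y \<omega> $ i"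
    using bound
  proof eventually_elim
    case (elim \<omega>)
    have "u $ j + Y \<omega> $ j \<le> u $ i + Y \<omega> $ i" for j
      using gap[of j] elim[rule_format, of i] elim[rule_format, of j] by (cases "j = i") auto
    then show ?case
      by (intro Max_eqI) auto
  qed
qed

lemma selection_premium_le_0: "selection_premium M Y u \<le> selection_premium M Y 0"
proof -
  have int: "integrable M (\<lambda>\<omega>. MAX k. Y \<omega> $ k)"
    using integrable_shifted_Max[of 0] by simp
  have "(MAX k. u $ k + Y \<omega> $ k) \<le> (MAX k. u $ k) + (MAX k. Y \<omega> $ k)" for \<omega>
    by (intro Max.boundedI) (auto intro!: add_mono)
  then have "expectation (\<lambda>\<omega>. MAX k. u $ k + Y \<omega> $ k)
      \<le> expectation (\<lambda>\<omega>. (MAX k. u $ k) + (MAX k. Y \<omega> $ k))"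
    using int by (intro integral_mono integrable_shifted_Max) auto
  \<comment> \<open>At \<open>u = 0\<close> the subtracted maximum is 0, so the premium there is the
    expectation of \<open>MAX k. Y \<omega> $ k\<close>.\<close>
  then show ?thesis
    using int by (simp add: selection_premium_def prob_space)
qed

end

text \<open>Domination by the maximal absolute value turns the moment hypothesis into the
  componentwise form required by the locale.\<close>

lemma integrable_component_if_integrable_Max_abs:
  fixes Y :: "'a \<Rightarrow> real ^ 'k::finite"
  assumes "Y \<in> borel_measurable M" "integrable M (\<lambda>\<omega>. MAX k. \<bar>Y \<omega> $ k\<bar>)"
  shows "integrable M (\<lambda>\<omega>. Y \<omega> $ k)"
proof (rule Bochner_Integration.integrable_bound[OF assms(2)])
  show "(\<lambda>\<omega>. Y \<omega> $ k) \<in> borel_measurable M"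
    using measurable_compose[OF assms(1) borel_measurable_nth] .
  have "\<bar>Y \<omega> $ k\<bar> \<le> (MAX k. \<bar>Y \<omega> $ k\<bar>)" for \<omega>
    by (intro Max_ge) auto
  then show "AE \<omega> in M. norm (Y \<omega> $ k) \<le> norm (MAX k. \<bar>Y \<omega> $ k\<bar>)"
    by (auto intro!: AE_I2 order_trans[OF _ abs_ge_self])
qed

theorem proposition3p3:
  fixes M :: "'a measure" and Y :: "'a \<Rightarrow> real ^ 'k::finite"
  assumes "prob_space M"
    and "Y \<in> borel_measurable M"
    and "\<And>k. prob_space.expectation M (\<lambda>\<omega>. Y \<omega> $ k) = 0"
    and "integrable M (\<lambda>\<omega>. MAX k. \<bar>Y \<omega> $ k\<bar>)"
  shows "(\<forall>u :: real ^ 'k. selection_premium M Y u \<ge> 0)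
    \<and> (CARD('k) = 1 \<longrightarrow> (\<forall>u :: real ^ 'k. selection_premium M Y u = 0))
    \<and> (\<forall>(u :: real ^ 'k) (c :: real).
         selection_premium M Y (u + c *\<^sub>R 1) = selection_premium M Y u)
    \<and> (\<forall>(b :: real) (u :: real ^ 'k) (kstar :: 'k).
         (AE \<omega> in M. \<forall>k. \<bar>Y \<omega> $ k\<bar> \<le> b) \<longrightarrow>
         is_arg_max (\<lambda>k. u $ k) (\<lambda>_. True) kstar \<longrightarrow>
         (MAX k. u $ k) - (MAX j\<in>UNIV - {kstar}. u $ j) > 2 * b \<longrightarrow>
         selection_premium M Y u = 0)
    \<and> (\<forall>u :: real ^ 'k. selection_premium M Y u \<le> selection_premium M Y 0)"
proof -
  interpret centered_increment M Y
    using assms integrable_component_if_integrable_Max_abs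
    by (intro centered_increment.intro centered_increment_axioms.intro) auto
  have "selection_premium M Y u = 0"
    if bound: "AE \<omega> in M. \<forall>k. \<bar>Y \<omega> $ k\<bar> \<le> b"
      and arg_max: "is_arg_max (\<lambda>k. u $ k) (\<lambda>_. True) kstar"
      and gap: "(MAX k. u $ k) - (MAX j\<in>UNIV - {kstar}. u $ j) > 2 * b"
    for b u kstar
  proof (rule selection_premium_eq_0_if_gap[OF bound])
    show max: "u $ j \<le> u $ kstar" for j
      using arg_max by (auto simp: is_arg_max_def not_less)
    then have "(MAX k. u $ k) = u $ kstar"
      by (intro Max_eqI) auto
    \<comment> \<open>If \<open>'k\<close> has one element, this maximum is over the empty set and
      unspecified; the condition on \<open>j\<close> then makes the claim vacuous.\<close>
    moreover have "u $ j \<le> (MAX j\<in>UNIV - {kstar}. u $ j)" if "j \<noteq> kstar" for j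
      using that by (intro Max_ge) auto
    ultimately show "u $ j + 2 * b \<le> u $ kstar" if "j \<noteq> kstar" for j
      using that gap by (smt (verit))
  qed
  then show ?thesis
    using selection_premium_nonneg selection_premium_card_1 selection_premium_translate
      selection_premium_le_0 by blast
qed

end
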